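(* For all $z,w,u,v,u',v'\in\mathbb{C}$, $$\sum_{m=0}^{+\infty}\sum_{n=0}^{+\infty}\sum_{m'=0}^{+\infty}\sum_{n'=0}^{+\infty}\frac{u^m}{m!}\frac{v^n}{n!}\frac{u'^{m'}}{m'!}\frac{v'^{n'}}{n'!}H_{m,n,m',n'}(z,w)=e^{-uv-u'v'}\,e^{z(u+v')+\overline{z}(v+u')+iw(u-v')+i\overline{w}(u'-v)}.$$
   Context: For integers $m,n\ge 0$ and $\zeta\in\mathbb{C}$, $H_{m,n}(\zeta,\overline{\zeta})=(-1)^{m+n}e^{|\zeta|^2}\frac{\partial^{m+n}}{\partial\overline{\zeta}^{m}\partial\zeta^{n}}\left(e^{-|\zeta|^2}\right)$ (Wirtinger derivatives), and for $(z,w)\in\mathbb{C}^2$, $H_{m,n,m',n'}(z,w)=H_{m,n}(z+iw,\overline{z}-i\overline{w})\,H_{m',n'}(\overline{z}+i\overline{w},z-iw)$. *)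

theory Defs
  imports "HOL-Analysis.Analysis"
begin

text \<open>
  Wirtinger operators \<open>\<partial>/\<partial>\<zeta> = (\<partial>/\<partial>x - \<i> \<partial>/\<partial>y) / 2\<close> and
  \<open>\<partial>/\<partial>cnj \<zeta> = (\<partial>/\<partial>x + \<i> \<partial>/\<partial>y) / 2\<close> for \<open>\<zeta> = x + \<i> y\<close>. They are meaningful only where
  the real partial derivatives exist, since \<^const>\<open>vector_derivative\<close> is a total function.
\<close>

definition partial_x :: "(complex \<Rightarrow> complex) \<Rightarrow> complex \<Rightarrow> complex" where
  "partial_x f \<zeta> = vector_derivative (\<lambda>t::real. f (\<zeta> + of_real t)) (at 0)"

definition partial_y :: "(complex \<Rightarrow> complex) \<Rightarrow> complex \<Rightarrow> complex" where
  "partial_y f \<zeta> = vector_derivative (\<lambda>t::real. f (\<zeta> + \<i> * of_real t)) (at 0)"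

definition wirtinger :: "(complex \<Rightarrow> complex) \<Rightarrow> complex \<Rightarrow> complex" where
  "wirtinger f \<zeta> = (partial_x f \<zeta> - \<i> * partial_y f \<zeta>) / 2"

definition wirtinger_bar :: "(complex \<Rightarrow> complex) \<Rightarrow> complex \<Rightarrow> complex" where
  "wirtinger_bar f \<zeta> = (partial_x f \<zeta> + \<i> * partial_y f \<zeta>) / 2"

text \<open>
  The polynomial \<open>H\<^sub>m\<^sub>,\<^sub>n(\<zeta>, cnj \<zeta>)\<close>. Its second argument is always the conjugate of the first, so
  it is a function of \<open>\<zeta>\<close> alone.
\<close>

definition hermite_H :: "nat \<Rightarrow> nat \<Rightarrow> complex \<Rightarrow> complex" where
  "hermite_H m n \<zeta> =
     (-1) ^ (m + n) * of_real (exp ((cmod \<zeta>)\<^sup>2)) *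
     (wirtinger_bar ^^ m) ((wirtinger ^^ n) (\<lambda>\<xi>. of_real (exp (- ((cmod \<xi>)\<^sup>2))))) \<zeta>"

text \<open>
  \<open>H\<^sub>m\<^sub>,\<^sub>n(z + \<i>w, cnj z - \<i> cnj w) H\<^sub>m\<^sub>'\<^sub>,\<^sub>n\<^sub>'(cnj z + \<i> cnj w, z - \<i>w)\<close>; in each factor the second
  argument is the conjugate of the first.
\<close>

definition hermite_H4 :: "nat \<Rightarrow> nat \<Rightarrow> nat \<Rightarrow> nat \<Rightarrow> complex \<Rightarrow> complex \<Rightarrow> complex" where
  "hermite_H4 m n m' n' z w =
     hermite_H m n (z + \<i> * w) * hermite_H m' n' (cnj z + \<i> * cnj w)"

definition gen_term ::
  "complex \<Rightarrow> complex \<Rightarrow> complex \<Rightarrow> complex \<Rightarrow> complex \<Rightarrow> complex \<Rightarrow>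
   nat \<Rightarrow> nat \<Rightarrow> nat \<Rightarrow> nat \<Rightarrow> complex" where
  "gen_term z w u v u' v' m n m' n' =
     u ^ m / fact m * (v ^ n / fact n) * (u' ^ m' / fact m') * (v' ^ n' / fact n') *
     hermite_H4 m n m' n' z w"

end

theory Submission
  imports Defs
begin

text \<open>
  Applying \<open>\<partial>/\<partial>cnj \<zeta>\<close> to \<open>H\<^sub>m\<^sub>,\<^sub>n exp (-\<zeta> cnj \<zeta>)\<close> and using
  \<open>\<partial>H\<^sub>m\<^sub>,\<^sub>n/\<partial>cnj \<zeta> = n H\<^sub>m\<^sub>,\<^sub>n\<^sub>-\<^sub>1\<close> gives the recurrence
  \<open>H\<^sub>m\<^sub>+\<^sub>1\<^sub>,\<^sub>n = \<zeta> H\<^sub>m\<^sub>,\<^sub>n - n H\<^sub>m\<^sub>,\<^sub>n\<^sub>-\<^sub>1\<close> with \<open>H\<^sub>0\<^sub>,\<^sub>n = (cnj \<zeta>)\<^sup>n\<close>.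
  On exponential generating functions in \<open>n\<close> the recurrence is multiplication by \<open>\<zeta> - v\<close>, so the sum
  over \<open>n\<close> is \<open>(\<zeta> - v)\<^sup>m exp (v cnj \<zeta>)\<close> and the sum over \<open>m\<close> is another exponential series.
  The four-fold sum is a product of two such double sums.
\<close>

text \<open>Every real-linear map of the plane has the form \<open>p * h + q * cnj h\<close>.
  Evaluating it at \<open>h = 1\<close> and \<open>h = \<i>\<close> gives the two partial
  derivatives, so one full derivative yields both Wirtinger derivatives.\<close>

lemma wirtinger_eqI:
  assumes "(f has_derivative (\<lambda>h. p * h + q * cnj h)) (at \<zeta>)"
  shows "wirtinger f \<zeta> = p" "wirtinger_bar f \<zeta> = q"
proof -
  have line: "vector_derivative (\<lambda>t::real. f (\<zeta> + c * of_real t)) (at 0) = p * c + q * cnj c" for c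
  proof -
    have "((\<lambda>t::real. \<zeta> + c * of_real t) has_derivative (\<lambda>t. c * of_real t)) (at 0)"
      by (auto intro!: derivative_eq_intros)
    moreover have "(f has_derivative (\<lambda>h. p * h + q * cnj h)) (at (\<zeta> + c * of_real 0))"
      using assms by simp
    ultimately have "((\<lambda>t::real. f (\<zeta> + c * of_real t)) has_derivative
        (\<lambda>t. p * (c * of_real t) + q * cnj (c * of_real t))) (at 0)"
      by (rule has_derivative_compose)
    then have "((\<lambda>t::real. f (\<zeta> + c * of_real t)) has_vector_derivative (p * c + q * cnj c)) (at 0)"
      unfolding has_vector_derivative_def by (simp add: scaleR_conv_of_real algebra_simps)
    then show ?thesis
      by (rule vector_derivative_at)
  qed
  have px: "partial_x f \<zeta> = p + q"
    using line[of 1] by (simp add: partial_x_def)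
  have py: "partial_y f \<zeta> = \<i> * (p - q)"
    using line[of \<i>] by (simp add: partial_y_def algebra_simps)
  show "wirtinger f \<zeta> = p" "wirtinger_bar f \<zeta> = q"
    unfolding wirtinger_def wirtinger_bar_def px py by (simp_all add: algebra_simps)
qed

definition gauss :: "complex \<Rightarrow> complex" where
  "gauss \<zeta> = exp (- (\<zeta> * cnj \<zeta>))"

lemma of_real_exp_cmod_power2: "of_real (exp ((cmod \<zeta>)\<^sup>2)) = exp (\<zeta> * cnj \<zeta>)"
  by (simp add: exp_of_real[symmetric] complex_norm_square[symmetric])

lemma gauss_eq: "gauss \<zeta> = of_real (exp (- ((cmod \<zeta>)\<^sup>2)))"
  by (simp add: gauss_def exp_of_real[symmetric] complex_norm_square[symmetric])

lemma has_derivative_gauss: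
  "(gauss has_derivative (\<lambda>h. - cnj \<zeta> * gauss \<zeta> * h + - \<zeta> * gauss \<zeta> * cnj h)) (at \<zeta>)"
proof -
  have "((\<lambda>\<zeta>. - (\<zeta> * cnj \<zeta>)) has_derivative (\<lambda>h. - (\<zeta> * cnj h + h * cnj \<zeta>))) (at \<zeta>)"
    by (intro derivative_intros)
  from has_derivative_compose[OF this DERIV_exp[unfolded has_field_derivative_def]]
  show ?thesis
    unfolding gauss_def[abs_def] by (simp add: algebra_simps)
qed

text \<open>For \<open>n = 0\<close> the truncated index \<open>n - 1\<close> is harmless because of the factor \<open>n\<close>.\<close>

fun hermite_poly :: "nat \<Rightarrow> nat \<Rightarrow> complex \<Rightarrow> complex" where
  "hermite_poly 0 n \<zeta> = cnj \<zeta> ^ n"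
| "hermite_poly (Suc m) n \<zeta> =
     \<zeta> * hermite_poly m n \<zeta> - of_nat n * hermite_poly m (n - 1) \<zeta>"

text \<open>Only the coefficient of \<open>cnj h\<close> is named, since it is what
  \<open>wirtinger_bar\<close> reads off. The induction generalises \<open>n\<close> because the
  recurrence also calls index \<open>n - 1\<close>.\<close>

lemma has_derivative_hermite_poly:
  "\<exists>p. (hermite_poly m n has_derivative
     (\<lambda>h. p * h + of_nat n * hermite_poly m (n - 1) \<zeta> * cnj h)) (at \<zeta>)"
proof (induction m arbitrary: n)
  case 0
  have "(hermite_poly 0 n has_derivative
      (\<lambda>h. 0 * h + of_nat n * hermite_poly 0 (n - 1) \<zeta> * cnj h)) (at \<zeta>)"
    unfolding hermite_poly.simps by (auto intro!: derivative_eq_intros simp: fun_eq_iff)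
  then show ?case ..
next
  case (Suc m)
  obtain p where p: "(hermite_poly m n has_derivative
      (\<lambda>h. p * h + of_nat n * hermite_poly m (n - 1) \<zeta> * cnj h)) (at \<zeta>)"
    using Suc by blast
  obtain p' where p': "(hermite_poly m (n - 1) has_derivative
      (\<lambda>h. p' * h + of_nat (n - 1) * hermite_poly m (n - 1 - 1) \<zeta> * cnj h)) (at \<zeta>)"
    using Suc by blast
  \<comment> \<open>The \<open>cnj h\<close> coefficients combine by the recurrence at index
    \<open>n - 1\<close>, after factoring out \<open>of_nat n\<close>.\<close>
  have "(hermite_poly (Suc m) n has_derivative
      (\<lambda>h. (hermite_poly m n \<zeta> + \<zeta> * p - of_nat n * p') * h +
        of_nat n * hermite_poly (Suc m) (n - 1) \<zeta> * cnj h)) (at \<zeta>)"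
    unfolding hermite_poly.simps
    by (rule has_derivative_eq_rhs, (rule derivative_intros p p')+)
      (simp add: fun_eq_iff algebra_simps)
  then show ?case ..
qed

text \<open>The power of \<open>cnj \<zeta>\<close> is antiholomorphic, so each
  \<open>wirtinger\<close> acts on \<open>gauss\<close> alone and contributes a factor
  \<open>- cnj \<zeta>\<close>.\<close>

lemma wirtinger_gauss:
  "(wirtinger ^^ n) gauss = (\<lambda>\<zeta>. (-1) ^ n * cnj \<zeta> ^ n * gauss \<zeta>)"
proof (induction n)
  case (Suc n)
  have "wirtinger (\<lambda>\<zeta>. (-1) ^ n * cnj \<zeta> ^ n * gauss \<zeta>) \<zeta> =
      (-1) ^ Suc n * cnj \<zeta> ^ Suc n * gauss \<zeta>" for \<zeta>
  proof (rule wirtinger_eqI)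
    show "((\<lambda>\<zeta>. (-1) ^ n * cnj \<zeta> ^ n * gauss \<zeta>) has_derivative
      (\<lambda>h. (-1) ^ Suc n * cnj \<zeta> ^ Suc n * gauss \<zeta> * h +
        (-1) ^ n * (of_nat n * cnj \<zeta> ^ (n - 1) - \<zeta> * cnj \<zeta> ^ n) * gauss \<zeta> * cnj h)) (at \<zeta>)"
      by (auto intro!: derivative_eq_intros has_derivative_gauss simp: fun_eq_iff algebra_simps)
  qed
  then show ?case
    by (simp add: Suc.IH fun_eq_iff)
qed simp

lemma wirtinger_bar_wirtinger_gauss:
  "(wirtinger_bar ^^ m) ((wirtinger ^^ n) gauss) =
     (\<lambda>\<zeta>. (-1) ^ (m + n) * hermite_poly m n \<zeta> * gauss \<zeta>)"
proof (induction m)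
  case 0
  show ?case by (simp add: wirtinger_gauss)
next
  case (Suc m)
  have "wirtinger_bar (\<lambda>\<zeta>. (-1) ^ (m + n) * hermite_poly m n \<zeta> * gauss \<zeta>) \<zeta> =
      (-1) ^ (Suc m + n) * hermite_poly (Suc m) n \<zeta> * gauss \<zeta>" for \<zeta>
  proof -
    obtain p where p: "(hermite_poly m n has_derivative
        (\<lambda>h. p * h + of_nat n * hermite_poly m (n - 1) \<zeta> * cnj h)) (at \<zeta>)"
      using has_derivative_hermite_poly by blast
    \<comment> \<open>The product rule gives \<open>of_nat n * hermite_poly m (n - 1) \<zeta> -
      \<zeta> * hermite_poly m n \<zeta>\<close> times \<open>gauss \<zeta>\<close>; this is minus
      the recurrence, whence the extra sign.\<close>
    have "((\<lambda>\<zeta>. (-1) ^ (m + n) * hermite_poly m n \<zeta> * gauss \<zeta>) has_derivative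
        (\<lambda>h. (-1) ^ (m + n) * (p - cnj \<zeta> * hermite_poly m n \<zeta>) * gauss \<zeta> * h +
          (-1) ^ (Suc m + n) * hermite_poly (Suc m) n \<zeta> * gauss \<zeta> * cnj h)) (at \<zeta>)"
      by (rule has_derivative_eq_rhs, (rule derivative_intros p has_derivative_gauss)+)
        (simp add: fun_eq_iff algebra_simps)
    then show ?thesis
      by (rule wirtinger_eqI)
  qed
  then show ?case
    by (simp add: Suc.IH fun_eq_iff)
qed

lemma hermite_H_eq: "hermite_H m n \<zeta> = hermite_poly m n \<zeta>"
proof -
  have "hermite_H m n \<zeta> = ((-1) ^ (m + n) * (-1) ^ (m + n)) *
      (exp (\<zeta> * cnj \<zeta>) * gauss \<zeta>) * hermite_poly m n \<zeta>"
    unfolding hermite_H_def gauss_eq[symmetric] wirtinger_bar_wirtinger_gauss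
      of_real_exp_cmod_power2
    by (simp only: mult_ac)
  then show ?thesis
    by (simp add: gauss_def exp_minus power_mult_distrib[symmetric])
qed

lemma sums_hermite_poly:
  "(\<lambda>n. v ^ n / fact n * hermite_poly m n \<zeta>) sums ((\<zeta> - v) ^ m * exp (v * cnj \<zeta>))"
proof (induction m)
  case 0
  show ?case
    using exp_converges[of "v * cnj \<zeta>"]
    by (simp add: scaleR_conv_of_real power_mult_distrib field_simps)
next
  case (Suc m)
  have "(\<lambda>n. v ^ Suc n / fact (Suc n) * (of_nat (Suc n) * hermite_poly m (Suc n - 1) \<zeta>)) sums
      (v * ((\<zeta> - v) ^ m * exp (v * cnj \<zeta>)))"
    using sums_mult[OF Suc.IH, of v] by (simp add: field_simps del: of_nat_Suc)
  \<comment> \<open>The term at \<open>n = 0\<close> vanishes, so undoing the shift leaves the sum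
    unchanged.\<close>
  then have "(\<lambda>n. v ^ n / fact n * (of_nat n * hermite_poly m (n - 1) \<zeta>)) sums
      (v * ((\<zeta> - v) ^ m * exp (v * cnj \<zeta>)))"
    by (subst (asm) sums_Suc_iff) simp
  from sums_diff[OF sums_mult[OF Suc.IH, of \<zeta>] this] show ?case
    by (simp add: algebra_simps)
qed

lemma sums_hermite_H_inner:
  "(\<lambda>n. u ^ m / fact m * (v ^ n / fact n) * hermite_H m n \<zeta>) sums
     (u ^ m / fact m * ((\<zeta> - v) ^ m * exp (v * cnj \<zeta>)))"
  unfolding hermite_H_eq mult.assoc by (intro sums_mult sums_hermite_poly)

lemma sums_hermite_H_outer:
  "(\<lambda>m. u ^ m / fact m * ((\<zeta> - v) ^ m * exp (v * cnj \<zeta>))) sums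
     exp (u * \<zeta> + v * cnj \<zeta> - u * v)"
proof -
  have "exp (u * (\<zeta> - v)) * exp (v * cnj \<zeta>) = exp (u * \<zeta> + v * cnj \<zeta> - u * v)"
    by (simp add: exp_add[symmetric] algebra_simps)
  with sums_mult2[OF exp_converges[of "u * (\<zeta> - v)"], of "exp (v * cnj \<zeta>)"] show ?thesis
    by (simp add: scaleR_conv_of_real power_mult_distrib divide_inverse mult_ac)
qed

theorem proposition3p28:
  fixes z w u v u' v' :: complex
  shows "(\<forall>m n m'. summable (\<lambda>n'. gen_term z w u v u' v' m n m' n')) \<and>
    (\<forall>m n. summable (\<lambda>m'. \<Sum>n'. gen_term z w u v u' v' m n m' n')) \<and>
    (\<forall>m. summable (\<lambda>n. \<Sum>m'. \<Sum>n'. gen_term z w u v u' v' m n m' n')) \<and>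
    (\<lambda>m. \<Sum>n. \<Sum>m'. \<Sum>n'. gen_term z w u v u' v' m n m' n') sums
      (exp (- u * v - u' * v') *
       exp (z * (u + v') + cnj z * (v + u') + \<i> * w * (u - v') + \<i> * cnj w * (u' - v)))"
proof -
  define \<zeta> \<zeta>' where "\<zeta> = z + \<i> * w" and "\<zeta>' = cnj z + \<i> * cnj w"
  \<comment> \<open>\<open>A\<close> is the factor free of \<open>m'\<close> and \<open>n'\<close>.
    Summing the other factor over \<open>n'\<close> gives \<open>B\<close>, and summing
    \<open>B\<close> over \<open>m'\<close> gives \<open>C\<close>; \<open>D\<close> is the sum of
    \<open>A\<close> over \<open>n\<close>.\<close>
  define A where "A m n = u ^ m / fact m * (v ^ n / fact n) * hermite_H m n \<zeta>" for m n
  define B where "B m = u' ^ m / fact m * ((\<zeta>' - v') ^ m * exp (v' * cnj \<zeta>'))" for m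
  define C where "C = exp (u' * \<zeta>' + v' * cnj \<zeta>' - u' * v')"
  define D where "D m = u ^ m / fact m * ((\<zeta> - v) ^ m * exp (v * cnj \<zeta>))" for m
  have gen: "gen_term z w u v u' v' m n m' n' =
      A m n * (u' ^ m' / fact m' * (v' ^ n' / fact n') * hermite_H m' n' \<zeta>')" for m n m' n'
    by (simp add: gen_term_def hermite_H4_def A_def \<zeta>_def \<zeta>'_def mult_ac)
  have s1: "(\<lambda>n'. gen_term z w u v u' v' m n m' n') sums (A m n * B m')" for m n m'
    unfolding gen B_def by (intro sums_mult sums_hermite_H_inner)
  have s2: "(\<lambda>m'. \<Sum>n'. gen_term z w u v u' v' m n m' n') sums (A m n * C)" for m n
    unfolding sums_unique[OF s1, symmetric] B_def C_def
    by (intro sums_mult sums_hermite_H_outer)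
  have s3: "(\<lambda>n. \<Sum>m'. \<Sum>n'. gen_term z w u v u' v' m n m' n') sums (D m * C)" for m
    unfolding sums_unique[OF s2, symmetric] A_def D_def
    by (intro sums_mult2 sums_hermite_H_inner)
  have s4: "(\<lambda>m. \<Sum>n. \<Sum>m'. \<Sum>n'. gen_term z w u v u' v' m n m' n') sums
      (exp (u * \<zeta> + v * cnj \<zeta> - u * v) * C)"
    unfolding sums_unique[OF s3, symmetric] D_def
    by (intro sums_mult2 sums_hermite_H_outer)
  \<comment> \<open>Here \<open>cnj \<zeta> = cnj z - \<i> * cnj w\<close> and
    \<open>cnj \<zeta>' = z - \<i> * w\<close>, so the exponents agree after expansion.\<close>
  have "exp (u * \<zeta> + v * cnj \<zeta> - u * v) * C = exp (- u * v - u' * v') *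
      exp (z * (u + v') + cnj z * (v + u') + \<i> * w * (u - v') + \<i> * cnj w * (u' - v))"
    by (simp add: C_def \<zeta>_def \<zeta>'_def exp_add[symmetric] algebra_simps)
  with s1 s2 s3 s4 show ?thesis
    by (auto simp: sums_iff)
qed

end
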